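(* Consider three particles of mass $1$ in $\mathbb{R}^2$ moving according to $\ddot q_i=\partial U/\partial q_i$, $i=1,2,3$, with the Manev potential $U(q_1,q_2,q_3)=\sum_{1\le i<j\le 3}\left(\frac{1}{\|q_i-q_j\|}+\frac{1}{\|q_i-q_j\|^2}\right)$. Let $z_0=(1,0,-\tfrac12,\tfrac{\sqrt3}{2},-\tfrac12,-\tfrac{\sqrt3}{2})^T\in\mathbb{R}^6$ be the vertices of the equilateral triangle inscribed in the unit circle, and let $\omega>0$ be the angular velocity for which the uniform rotation of $z_0$ about the origin is a solution, namely $\omega^2=\frac23+\frac1{\sqrt3}$. Then the corresponding relative equilibrium is (linearly) unstable: the linearized system at it has an eigenvalue with positive real part.
   Context: A configuration $z=(a_1,\dots,a_n)\in(\mathbb{R}^2)^n$ together with $\omega>0$ defines a relative equilibrium if $q_i(t)=\exp(-\omega Jt)a_i$, where $J=\begin{pmatrix}0&1\\-1&0\end{pmatrix}$ and hence $\exp(-\omega Jt)=\begin{pmatrix}\cos\omega t&-\sin\omega t\\ \sin\omega t&\cos\omega t\end{pmatrix}$, solves the equations of motion. In the rotating coordinates $q_i=\exp(-\omega Jt)x_i$ the equations become $\ddot x_i=2\omega J\dot x_i+\omega^2x_i+\nabla_{x_i}U$ (unit masses), and the relative equilibrium becomes the equilibrium $x=z$. The linearized system at it is $\ddot X=2\omega\mathbf{J}\dot X+\omega^2X+D^2U(z)X$ for $X\in\mathbb{R}^{2n}$, where $\mathbf{J}=\mathrm{diag}(J,\dots,J)$ ($n$ blocks) and $D^2U(z)$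 is the Hessian of $U$ at $z$. Its eigenvalues are those of the $4n\times4n$ matrix $\begin{pmatrix}0&I_{2n}\\ \omega^2I_{2n}+D^2U(z)&2\omega\mathbf{J}\end{pmatrix}$. The relative equilibrium is called (linearly) unstable if this matrix has an eigenvalue with positive real part. *)

theory Defs
  imports "HOL-Analysis.Analysis"
begin

text \<open>
  A planar configuration \<open>x\<close> of particles indexed by \<open>'n\<close> is a point of \<open>real ^ ('n \<times> 2)\<close>, that is
  of \<open>\<real>\<^sup>2\<^sup>n\<close>; the entry \<open>x $ (i, k)\<close> is the \<open>k\<close>-th coordinate of particle \<open>i\<close>.
\<close>

definition position :: "real ^ ('n \<times> 2) \<Rightarrow> 'n::finite \<Rightarrow> real ^ 2" where
  "position x i = (\<chi> k. x $ (i, k))"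

text \<open>
  The order on the index type only serves to list every unordered pair of particles once.
  Division by zero makes the summand of a colliding pair \<open>0\<close>; the potential is not differentiable at
  such configurations, so they never lie on a solution of the equations of motion below.
\<close>

definition manev :: "real ^ ('n::{finite,linorder} \<times> 2) \<Rightarrow> real" where
  "manev q = (\<Sum>(i, j) \<in> {(i, j). i < j}.
      1 / norm (position q i - position q j) + 1 / (norm (position q i - position q j))\<^sup>2)"

definition solves_newton :: "(real ^ 'm \<Rightarrow> real) \<Rightarrow> (real \<Rightarrow> real ^ 'm) \<Rightarrow> bool" where
  "solves_newton U q \<longleftrightarrow>
     (\<exists>v a. \<forall>t. (q has_vector_derivative v t) (at t) \<and> (v has_vector_derivative a t) (at t) \<and>
        GDERIV U (q t) :> a t)"

definition J :: "real ^ 2 ^ 2" where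
  "J = vector [vector [0, 1], vector [-1, 0]]"

text \<open>The matrix \<open>exp (- \<theta> J)\<close>, characterised by the two lemmas that follow it.\<close>

definition rotation :: "real \<Rightarrow> real ^ 2 ^ 2" where
  "rotation \<theta> = vector [vector [cos \<theta>, - sin \<theta>], vector [sin \<theta>, cos \<theta>]]"

lemma rotation_0: "rotation 0 = mat 1"
  by (simp add: rotation_def vec_eq_iff forall_2 mat_def)

lemma rotation_has_vector_derivative:
  "(rotation has_vector_derivative (- J) ** rotation \<theta>) (at \<theta>)"
proof -
  have eq: "rotation = (\<lambda>t. cos t *\<^sub>R mat 1 - sin t *\<^sub>R J)"
    by (simp add: fun_eq_iff rotation_def J_def vec_eq_iff forall_2 mat_def)
  have "(rotation has_vector_derivative (- sin \<theta>) *\<^sub>R mat 1 - cos \<theta> *\<^sub>R J) (at \<theta>)"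
    unfolding eq by (auto intro!: derivative_eq_intros)
  moreover have "(- sin \<theta>) *\<^sub>R mat 1 - cos \<theta> *\<^sub>R J = (- J) ** rotation \<theta>"
    by (simp add: rotation_def J_def vec_eq_iff forall_2 mat_def matrix_matrix_mult_def sum_2)
  ultimately show ?thesis
    by simp
qed

definition rotate_config :: "real \<Rightarrow> real ^ ('n::finite \<times> 2) \<Rightarrow> real ^ ('n \<times> 2)" where
  "rotate_config \<theta> x = (\<chi> p. (rotation \<theta> *v position x (fst p)) $ snd p)"

definition relative_equilibrium ::
    "(real ^ ('n::finite \<times> 2) \<Rightarrow> real) \<Rightarrow> real \<Rightarrow> real ^ ('n \<times> 2) \<Rightarrow> bool" where
  "relative_equilibrium U \<omega> z \<longleftrightarrow> \<omega> > 0 \<and> solves_newton U (\<lambda>t. rotate_config (\<omega> * t) z)"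

definition gradient :: "(real ^ 'm \<Rightarrow> real) \<Rightarrow> real ^ 'm \<Rightarrow> real ^ 'm" where
  "gradient U x = (THE g. GDERIV U x :> g)"

definition hessian :: "(real ^ 'm \<Rightarrow> real) \<Rightarrow> real ^ 'm \<Rightarrow> real ^ 'm ^ 'm" where
  "hessian U x = jacobian (gradient U) (at x)"

definition block_J :: "real ^ ('n::finite \<times> 2) ^ ('n \<times> 2)" where
  "block_J = (\<chi> p r. if fst p = fst r then J $ snd p $ snd r else 0)"

definition block_matrix ::
    "'a ^ 'm ^ 'm \<Rightarrow> 'a ^ 'm ^ 'm \<Rightarrow> 'a ^ 'm ^ 'm \<Rightarrow> 'a ^ 'm ^ 'm \<Rightarrow> 'a ^ ('m + 'm) ^ ('m + 'm)" where
  "block_matrix A B C D = (\<chi> p r.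
     (case p of
        Inl i \<Rightarrow> (case r of Inl j \<Rightarrow> A $ i $ j | Inr j \<Rightarrow> B $ i $ j)
      | Inr i \<Rightarrow> (case r of Inl j \<Rightarrow> C $ i $ j | Inr j \<Rightarrow> D $ i $ j)))"

text \<open>
  The matrix of \<open>X'' = 2 \<omega> \<^bold>J X' + \<omega>\<^sup>2 X + D\<^sup>2U(z) X\<close>, written as a first-order system in \<open>(X, X')\<close>.
\<close>

definition linearization ::
    "(real ^ ('n::finite \<times> 2) \<Rightarrow> real) \<Rightarrow> real \<Rightarrow> real ^ ('n \<times> 2) \<Rightarrow>
     real ^ (('n \<times> 2) + ('n \<times> 2)) ^ (('n \<times> 2) + ('n \<times> 2))" where
  "linearization U \<omega> z =
     block_matrix 0 (mat 1) (\<omega>\<^sup>2 *\<^sub>R mat 1 + hessian U z) ((2 * \<omega>) *\<^sub>R block_J)"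

definition is_eigenvalue :: "complex ^ 'm ^ 'm \<Rightarrow> complex \<Rightarrow> bool" where
  "is_eigenvalue A c \<longleftrightarrow> (\<exists>v. v \<noteq> 0 \<and> A *v v = c *s v)"

definition linearly_unstable ::
    "(real ^ ('n::finite \<times> 2) \<Rightarrow> real) \<Rightarrow> real \<Rightarrow> real ^ ('n \<times> 2) \<Rightarrow> bool" where
  "linearly_unstable U \<omega> z \<longleftrightarrow>
     (\<exists>c. is_eigenvalue (map_matrix complex_of_real (linearization U \<omega> z)) c \<and> Re c > 0)"

definition equilateral_triangle :: "real ^ (3 \<times> 2)" where
  "equilateral_triangle = (\<chi> p. (vector [vector [1, 0], vector [- 1 / 2, sqrt 3 / 2],
     vector [- 1 / 2, - sqrt 3 / 2]] :: real ^ 2 ^ 3) $ fst p $ snd p)"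

end

theory Submission
  imports Defs
begin

text \<open>
  In complex notation, an equilateral triangle with vertices \<open>w\<^sup>k\<close>, \<open>w = exp (2 \<pi> \<i> / 3)\<close>, has besides its
  translations and homographic motions the mode \<open>X\<^sub>k = u w\<^sup>-\<^sup>k\<close>, \<open>u \<in> \<complex>\<close>. This is a real plane
  on which the Hessian acts as a scalar \<open>\<kappa>\<close>, and which \<open>\<^bold>J\<close> preserves. On it the linearized system is
  \<open>u'' = - 2 \<i> \<omega> u' + (\<omega>\<^sup>2 + \<kappa>) u\<close>, whose exponents have real parts \<open>\<plusminus> sqrt \<kappa>\<close>;
  for the Manev potential \<open>\<kappa> = 2 / 3 + 1 / (2 sqrt 3) > 0\<close>.
\<close>

section \<open>Gradient and Hessian of the Manev potential\<close>

definition separate :: "'n::finite \<Rightarrow> 'n \<Rightarrow> real ^ 2 \<Rightarrow> real ^ ('n \<times> 2)" where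
  "separate i j y = (\<chi> p. of_bool (fst p = i) * y $ snd p - of_bool (fst p = j) * y $ snd p)"

text \<open>This adjoint relation turns the derivative of a pair term, which sees \<open>h\<close>
  only through \<open>position h i - position h j\<close>, into a gradient on the whole
  configuration space.\<close>

lemma inner_separate: "h \<bullet> separate i j y = (position h i - position h j) \<bullet> y"
proof -
  have "h \<bullet> separate i j y =
      (\<Sum>l\<in>UNIV. \<Sum>k\<in>UNIV. h $ (l, k) * (of_bool (l = i) * y $ k - of_bool (l = j) * y $ k))"
    by (simp add: inner_vec_def separate_def sum.cartesian_product split_def)
  also have "\<dots> = (\<Sum>k\<in>UNIV. \<Sum>l\<in>UNIV.
      of_bool (l = i) * (h $ (l, k) * y $ k) - of_bool (l = j) * (h $ (l, k) * y $ k))"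
    by (subst sum.swap) (simp add: algebra_simps)
  also have "\<dots> = (position h i - position h j) \<bullet> y"
    by (simp add: inner_vec_def position_def sum_subtractf of_bool_def if_distrib[of "\<lambda>c. c * _"]
        left_diff_distrib cong: if_cong)
  finally show ?thesis .
qed

text \<open>Removes the order on the particles: by antisymmetry a pair contributes in the same form
  to both of its members, so each row becomes a sum over all \<open>j\<close>, the diagonal term
  being zero.\<close>

lemma sum_separate_nth:
  fixes \<Phi> :: "'n::{finite,linorder} \<Rightarrow> 'n \<Rightarrow> real ^ 2"
  assumes antisymmetric: "\<And>i j. \<Phi> j i = - \<Phi> i j"
  shows "(\<Sum>(i, j) \<in> {(i, j). i < j}. separate i j (\<Phi> i j)) $ p = (\<Sum>j\<in>UNIV. \<Phi> (fst p) j $ snd p)"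
proof -
  have diag: "\<Phi> i i = 0" for i
    using antisymmetric[of i i] by (simp add: eq_neg_iff_add_eq_0 flip: scaleR_2)
  let ?s = "\<lambda>i j. \<Phi> i j $ snd p"
  have *: "(\<Sum>(i, j) \<in> {(i, j). i < j}. f i j) = (\<Sum>i\<in>UNIV. \<Sum>j\<in>UNIV. of_bool (i < j) * f i j)"
    for f :: "'n \<Rightarrow> 'n \<Rightarrow> real"
  proof -
    have "(\<Sum>(i, j) \<in> {(i, j). i < j}. f i j) = (\<Sum>(i, j) \<in> UNIV. of_bool (i < j) * f i j)"
      by (rule sum.mono_neutral_cong_left) auto
    then show ?thesis
      unfolding sum.cartesian_product UNIV_Times_UNIV .
  qed
  have "(\<Sum>(i, j) \<in> {(i, j). i < j}. separate i j (\<Phi> i j)) $ p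
      = (\<Sum>(i, j) \<in> {(i, j). i < j}. of_bool (fst p = i) * ?s i j - of_bool (fst p = j) * ?s i j)"
    by (simp add: sum_component separate_def split_def)
  also have "\<dots> = (\<Sum>i\<in>UNIV. \<Sum>j\<in>UNIV. of_bool (i < j) *
      (of_bool (fst p = i) * ?s i j - of_bool (fst p = j) * ?s i j))"
    by (rule *)
  \<comment> \<open>Only the subtracted half is swapped, so that in both halves the index tied to
    \<open>fst p\<close> is the outer one and its sum collapses.\<close>
  also have "\<dots> = (\<Sum>i\<in>UNIV. \<Sum>j\<in>UNIV. of_bool (fst p = i) * (of_bool (i < j) * ?s i j))
      - (\<Sum>j\<in>UNIV. \<Sum>i\<in>UNIV. of_bool (fst p = j) * (of_bool (i < j) * ?s i j))"
    by (subst (3) sum.swap) (simp add: algebra_simps sum_subtractf)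
  also have "\<dots> = (\<Sum>j\<in>UNIV. of_bool (fst p < j) * ?s (fst p) j) -
     (\<Sum>i\<in>UNIV. of_bool (i < fst p) * ?s i (fst p))"
    by (simp flip: sum_distrib_left)
  also have "\<dots> = (\<Sum>j\<in>UNIV. of_bool (fst p < j) * ?s (fst p) j + of_bool (j < fst p) * ?s (fst p) j)"
    by (simp add: antisymmetric[of _ "fst p"] sum.distrib sum_negf)
  also have "\<dots> = (\<Sum>j\<in>UNIV. ?s (fst p) j)"
    by (intro sum.cong refl) (auto simp: diag neq_iff)
  finally show ?thesis .
qed

text \<open>The gradient of 1/r + 1/r^2, r = \<open>norm d\<close>, with respect to the difference
  vector \<open>d\<close>; \<open>manev_stiffness d\<close> is its derivative for nonzero
  \<open>d\<close>. Both vanish at \<open>d = 0\<close>, so diagonal terms in sums over all pairs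
  are harmless.\<close>

definition manev_force :: "'a::real_inner \<Rightarrow> 'a" where
  "manev_force d = - (1 / norm d ^ 3 + 2 / norm d ^ 4) *\<^sub>R d"

definition manev_stiffness :: "'a::real_inner \<Rightarrow> 'a \<Rightarrow> 'a" where
  "manev_stiffness d h =
     ((3 / norm d ^ 5 + 8 / norm d ^ 6) * (d \<bullet> h)) *\<^sub>R d - (1 / norm d ^ 3 + 2 / norm d ^ 4) *\<^sub>R h"

lemma manev_pair_has_derivative:
  assumes "d \<noteq> 0"
  shows "((\<lambda>d. 1 / norm d + 1 / (norm d)\<^sup>2) has_derivative (\<lambda>h. h \<bullet> manev_force d)) (at d)"
proof -
  have "GDERIV (\<lambda>d. 1 / norm d + 1 / (norm d)\<^sup>2) d :>
      (- 1 / (norm d)\<^sup>2 - 2 / norm d ^ 3) *\<^sub>R sgn d"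
    by (rule GDERIV_DERIV_compose[OF GDERIV_norm[OF assms]])
      (use assms in \<open>auto intro!: derivative_eq_intros simp: field_simps power_numeral_reduce\<close>)
  also have "(- 1 / (norm d)\<^sup>2 - 2 / norm d ^ 3) *\<^sub>R sgn d = manev_force d"
    using assms
    by (simp add: manev_force_def sgn_div_norm field_simps power_numeral_reduce flip: scaleR_minus_left)
  finally show ?thesis
    by (simp add: gderiv_def)
qed

lemma manev_force_has_derivative:
  assumes "d \<noteq> 0"
  shows "(manev_force has_derivative manev_stiffness d) (at d)"
proof -
  have "((\<lambda>r. - (1 / r ^ 3 + 2 / r ^ 4)) has_real_derivative 3 / norm d ^ 4 + 8 / norm d ^ 5)
      (at (norm d))"
    using assms by (auto intro!: derivative_eq_intros simp: field_simps power_numeral_reduce)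
  from GDERIV_DERIV_compose[OF GDERIV_norm[OF assms] this]
  have "((\<lambda>d. - (1 / norm d ^ 3 + 2 / norm d ^ 4)) has_derivative
      (\<lambda>h. h \<bullet> ((3 / norm d ^ 4 + 8 / norm d ^ 5) *\<^sub>R sgn d))) (at d)"
    by (simp add: gderiv_def)
  from has_derivative_scaleR[OF this has_derivative_ident]
  show ?thesis
    unfolding manev_force_def [abs_def]
    by (rule has_derivative_eq_rhs)
      (use assms in \<open>simp add: manev_stiffness_def fun_eq_iff sgn_div_norm field_simps
        power_numeral_reduce inner_commute scaleR_diff_left\<close>)
qed

lemma manev_force_minus: "manev_force (- d) = - manev_force d"
  by (simp add: manev_force_def)

lemma manev_stiffness_minus: "manev_stiffness (- d) (- h) = - manev_stiffness d h"
  by (simp add: manev_stiffness_def)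

lemma bounded_linear_position_diff: "bounded_linear (\<lambda>q. position q i - position q j)"
  unfolding linear_conv_bounded_linear[symmetric]
  by (rule linearI) (simp_all add: position_def vec_eq_iff algebra_simps)

lemma bounded_linear_separate: "bounded_linear (separate i j)"
  unfolding linear_conv_bounded_linear[symmetric]
  by (rule linearI) (simp_all add: separate_def vec_eq_iff algebra_simps)

definition manev_gradient :: "real ^ ('n::{finite,linorder} \<times> 2) \<Rightarrow> real ^ ('n \<times> 2)" where
  "manev_gradient q =
     (\<Sum>(i, j) \<in> {(i, j). i < j}. separate i j (manev_force (position q i - position q j)))"

definition manev_hessian ::
    "real ^ ('n::{finite,linorder} \<times> 2) \<Rightarrow> real ^ ('n \<times> 2) \<Rightarrow> real ^ ('n \<times> 2)" where
  "manev_hessian q h = (\<Sum>(i, j) \<in> {(i, j). i < j}. separate i j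
     (manev_stiffness (position q i - position q j) (position h i - position h j)))"

lemma GDERIV_manev:
  assumes "inj (position q)"
  shows "GDERIV manev q :> manev_gradient q"
proof -
  have "(manev has_derivative (\<lambda>h. \<Sum>(i, j) \<in> {(i, j). i < j}.
      (position h i - position h j) \<bullet> manev_force (position q i - position q j))) (at q)"
    unfolding manev_def [abs_def] split_def
    using assms
    by (intro has_derivative_sum has_derivative_compose[OF
        bounded_linear_imp_has_derivative[OF bounded_linear_position_diff] manev_pair_has_derivative])
      (auto simp: inj_eq)
  then show ?thesis
    by (simp add: gderiv_def manev_gradient_def inner_sum_right inner_separate split_def)
qed

lemma manev_gradient_has_derivative:
  assumes "inj (position q)"
  shows "(manev_gradient has_derivative manev_hessian q) (at q)"
  unfolding manev_gradient_def [abs_def] manev_hessian_def [abs_def] split_def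
  using assms
  by (intro has_derivative_sum bounded_linear.has_derivative[OF bounded_linear_separate] has_derivative_compose[OF
        bounded_linear_imp_has_derivative[OF bounded_linear_position_diff] manev_force_has_derivative])
      (auto simp: inj_eq)

lemma manev_gradient_nth:
  "manev_gradient q $ p = (\<Sum>j\<in>UNIV. manev_force (position q (fst p) - position q j) $ snd p)"
  unfolding manev_gradient_def
  by (rule sum_separate_nth) (simp flip: manev_force_minus)

lemma manev_hessian_nth:
  "manev_hessian q h $ p = (\<Sum>j\<in>UNIV.
     manev_stiffness (position q (fst p) - position q j) (position h (fst p) - position h j) $ snd p)"
  unfolding manev_hessian_def
  by (rule sum_separate_nth) (simp flip: manev_stiffness_minus)

lemma GDERIV_unique: "GDERIV f x :> D \<Longrightarrow> GDERIV f x :> E \<Longrightarrow> D = E"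
  unfolding gderiv_def by (drule (1) has_derivative_unique) (simp add: fun_eq_iff vector_eq_ldot)

text \<open>\<open>hessian\<close> differentiates \<open>gradient manev\<close>, which is identified
  with \<open>manev_gradient\<close> at collision-free configurations. Openness of that set lets the
  derivative pass from one function to the other.\<close>

lemma open_inj_position: "open {q :: real ^ ('n::finite \<times> 2). inj (position q)}"
proof -
  have "{q :: real ^ ('n \<times> 2). inj (position q)} =
      (\<Inter>(i, j)\<in>{(i, j). i \<noteq> j}. {q. position q i - position q j \<noteq> 0})"
    by (auto simp: inj_def)
  also have "open \<dots>"
    by (intro open_INT) (auto intro!: open_Collect_neq linear_continuous_on bounded_linear_position_diff simp del: right_minus_eq)
  finally show ?thesis .
qed

lemma hessian_manev:
  assumes "inj (position q)"
  shows "hessian manev q *v h = manev_hessian q h"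
proof -
  have "gradient manev x = manev_gradient x" if "inj (position x)" for x :: "real ^ ('a \<times> 2)"
    unfolding gradient_def using GDERIV_manev[OF that] GDERIV_unique by blast
  then have *: "(gradient manev has_derivative manev_hessian q) (at q)"
    using assms
    by (intro has_derivative_transform_within_open[OF manev_gradient_has_derivative open_inj_position]) auto
  then have "manev_hessian q = (\<lambda>h. hessian manev q *v h)"
    unfolding hessian_def using jacobian_works differentiableI has_derivative_unique by blast
  then show ?thesis by simp
qed


section \<open>Rotating configurations and their angular velocity\<close>

lemma position_rotate_config: "position (rotate_config \<theta> z) i = rotation \<theta> *v position z i"
  by (simp add: rotate_config_def position_def vec_eq_iff)

lemma norm_rotation: "norm (rotation \<theta> *v x) = norm x"
proof -
  have "(cos \<theta> * a - sin \<theta> * b)\<^sup>2 + (sin \<theta> * a + cos \<theta> * b)\<^sup>2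
      = ((sin \<theta>)\<^sup>2 + (cos \<theta>)\<^sup>2) * (a\<^sup>2 + b\<^sup>2)" for a b :: real
    by algebra
  then show ?thesis
    by (simp add: norm_eq_sqrt_inner inner_vec_def sum_2 rotation_def matrix_vector_mult_def
        flip: power2_eq_square)
qed

text \<open>Uniform rotation has acceleration \<open>- \<omega>\<^sup>2 *\<^sub>R q t\<close>, while
  the force along the whole orbit is \<open>- c *\<^sub>R q t\<close>; as \<open>z\<close> is
  nonzero, Newton's equation reduces to equality of the two scalars.\<close>

lemma relative_equilibrium_iff_central:
  fixes z :: "real ^ ('n::finite \<times> 2)"
  assumes "\<omega> > 0" "z \<noteq> 0"
    and central: "\<And>\<theta>. GDERIV U (rotate_config \<theta> z) :> - c *\<^sub>R rotate_config \<theta> z"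
  shows "relative_equilibrium U \<omega> z \<longleftrightarrow> \<omega>\<^sup>2 = c"
proof -
  define q where "q = (\<lambda>t. rotate_config (\<omega> * t) z)"
  \<comment> \<open>The quarter turn of \<open>z\<close>: the orbit becomes a combination of two
    fixed vectors with coefficients cos and sin.\<close>
  define z' where "z' = rotate_config (pi / 2) z"
  define v where "v = (\<lambda>t. \<omega> *\<^sub>R (cos (\<omega> * t) *\<^sub>R z' - sin (\<omega> * t) *\<^sub>R z))"
  have q_eq: "q = (\<lambda>t. cos (\<omega> * t) *\<^sub>R z + sin (\<omega> * t) *\<^sub>R z')"
    by (auto simp: q_def z'_def fun_eq_iff rotate_config_def rotation_def position_def vec_eq_iff
        forall_2 matrix_vector_mult_def sum_2)
  have q': "(q has_vector_derivative v t) (at t)" for t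
    unfolding q_eq v_def
    by (auto intro!: derivative_eq_intros simp: algebra_simps)
  have v': "(v has_vector_derivative - \<omega>\<^sup>2 *\<^sub>R q t) (at t)" for t
    unfolding q_eq v_def
    by (auto intro!: derivative_eq_intros simp: algebra_simps power2_eq_square)
  have "q 0 = z"
    by (simp add: q_eq)
  have "solves_newton U q \<longleftrightarrow> \<omega>\<^sup>2 = c"
  proof
    assume "solves_newton U q"
    then obtain w a where w: "\<And>t. (q has_vector_derivative w t) (at t)"
      and a: "\<And>t. (w has_vector_derivative a t) (at t)"
      and U: "\<And>t. GDERIV U (q t) :> a t"
      unfolding solves_newton_def by blast
    \<comment> \<open>Uniqueness of derivatives forces the velocity and acceleration that
      \<open>solves_newton\<close> merely asserts to exist.\<close>
    have "w = v"
      using w q' vector_derivative_unique_at by blast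
    then have "a 0 = - \<omega>\<^sup>2 *\<^sub>R z"
      using a v' vector_derivative_unique_at \<open>q 0 = z\<close> by metis
    moreover have "a 0 = - c *\<^sub>R z"
      using GDERIV_unique[OF U[of 0]] central[of 0] \<open>q 0 = z\<close> by (simp add: q_def)
    ultimately show "\<omega>\<^sup>2 = c"
      using \<open>z \<noteq> 0\<close> by simp
  next
    assume c: "\<omega>\<^sup>2 = c"
    have "GDERIV U (q t) :> - \<omega>\<^sup>2 *\<^sub>R q t" for t
      using central[of "\<omega> * t"] by (simp only: c q_def)
    then show "solves_newton U q"
      unfolding solves_newton_def by (intro exI allI conjI) (rule q' v' | assumption)+
  qed
  then show ?thesis
    using \<open>\<omega> > 0\<close> by (simp add: relative_equilibrium_def q_def)
qed

text \<open>With a common distance every pair force is the same multiple of the difference vector,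
  and since the positions sum to zero, the differences from particle \<open>i\<close> sum to
  \<open>CARD('n)\<close> times its position.\<close>

lemma manev_gradient_equidistant:
  fixes q :: "real ^ ('n::{finite,linorder} \<times> 2)"
  assumes dist: "\<And>i j. i \<noteq> j \<Longrightarrow> norm (position q i - position q j) = r"
    and center: "(\<Sum>i\<in>UNIV. position q i) = 0"
  shows "manev_gradient q = - (CARD('n) * (1 / r ^ 3 + 2 / r ^ 4)) *\<^sub>R q"
proof -
  define k where "k = 1 / r ^ 3 + 2 / r ^ 4"
  have force: "manev_force (position q i - position q j) = - k *\<^sub>R (position q i - position q j)" for i j
    by (cases "i = j") (simp_all add: manev_force_def k_def dist)
  have "manev_gradient q $ (i, l) = - (CARD('n) * k) * q $ (i, l)" for i l
  proof -
    have "manev_gradient q $ (i, l) =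
        (\<Sum>j\<in>UNIV. - k *\<^sub>R (position q i - position q j)) $ l"
      by (simp add: manev_gradient_nth force sum_component)
    also have "(\<Sum>j\<in>UNIV. - k *\<^sub>R (position q i - position q j)) = - (CARD('n) * k) *\<^sub>R position q i"
      unfolding scaleR_right.sum[symmetric] sum_subtractf center
      by (simp add: sum_constant_scaleR mult.commute del: sum_constant)
    finally show ?thesis
      by (simp add: position_def)
  qed
  then show ?thesis
    by (simp add: vec_eq_iff k_def)
qed

lemma norm_equilateral_triangle:
  assumes "i \<noteq> j"
  shows "norm (position equilateral_triangle i - position equilateral_triangle j) = sqrt 3"
proof -
  have "\<forall>i j. i \<noteq> j \<longrightarrow>
      norm (position equilateral_triangle i - position equilateral_triangle j) = sqrt 3"
    by (simp add: forall_3 norm_eq_sqrt_inner inner_vec_def sum_2 position_def equilateral_triangle_def)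
  then show ?thesis
    using assms by blast
qed

lemma sum_equilateral_triangle: "(\<Sum>i\<in>UNIV. position equilateral_triangle i) = 0"
  by (simp add: sum_3 position_def equilateral_triangle_def vec_eq_iff forall_2)

lemma inj_position_if_equidistant:
  assumes "\<And>i j. i \<noteq> j \<Longrightarrow> norm (position q i - position q j) = r" "r > 0"
  shows "inj (position q)"
  using assms by (metis injI less_irrefl norm_zero right_minus_eq)

lemma sqrt_3_powers:
  "sqrt 3 ^ 3 = 3 * sqrt 3" "sqrt 3 ^ 4 = 9" "sqrt 3 ^ 5 = 9 * sqrt 3" "sqrt 3 ^ 6 = 27"
  by (simp_all add: eval_nat_numeral mult.assoc)

text \<open>Rotation preserves the mutual distances sqrt 3 and the centre 0, so every rotated
  triangle falls under the equidistant case.\<close>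

lemma GDERIV_manev_equilateral_triangle:
  fixes \<theta> :: real
  defines "q \<equiv> rotate_config \<theta> equilateral_triangle"
  shows "GDERIV manev q :> - (2 / 3 + 1 / sqrt 3) *\<^sub>R q"
proof -
  have dist: "norm (position q i - position q j) = sqrt 3" if "i \<noteq> j" for i j
    using norm_equilateral_triangle[OF that]
    by (simp add: q_def position_rotate_config norm_rotation flip: matrix_vector_mult_diff_distrib)
  have "(\<Sum>i\<in>UNIV. position q i) = rotation \<theta> *v (\<Sum>i\<in>UNIV. position equilateral_triangle i)"
    by (simp add: q_def position_rotate_config sum_3 matrix_vector_right_distrib)
  then have "(\<Sum>i\<in>UNIV. position q i) = 0"
    by (simp add: sum_equilateral_triangle)
  from manev_gradient_equidistant[OF dist this]
  have "manev_gradient q = - (3 * (1 / sqrt 3 ^ 3 + 2 / sqrt 3 ^ 4)) *\<^sub>R q"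
    by simp
  also have "3 * (1 / sqrt 3 ^ 3 + 2 / sqrt 3 ^ 4) = 2 / 3 + 1 / sqrt 3"
    by (simp add: sqrt_3_powers field_simps)
  finally show ?thesis
    using GDERIV_manev[OF inj_position_if_equidistant[OF dist]] by simp
qed

section \<open>An unstable eigenvector of the complexified linearization\<close>

lemma map_matrix_of_real_mult_Complex:
  "map_matrix complex_of_real A *v (\<chi> p. Complex (x $ p) (y $ p)) =
     (\<chi> p. Complex ((A *v x) $ p) ((A *v y) $ p))"
  by (simp add: vec_eq_iff matrix_vector_mult_def complex_eq_iff)

lemma block_J_mult: "(block_J *v x) $ (i, l) = (J *v position x i) $ l"
proof -
  have "(block_J *v x) $ (i, l) = (\<Sum>(j, m)\<in>UNIV. of_bool (i = j) * (J $ l $ m * x $ (j, m)))"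
    by (simp add: matrix_vector_mult_def block_J_def split_def of_bool_def if_distrib[of "\<lambda>c. c * _"] cong: if_cong)
  also have "\<dots> = (\<Sum>j\<in>UNIV. of_bool (i = j) * (\<Sum>m\<in>UNIV. J $ l $ m * x $ (j, m)))"
    unfolding sum_distrib_left sum.cartesian_product UNIV_Times_UNIV ..
  also have "\<dots> = (J *v position x i) $ l"
    by (simp add: matrix_vector_mult_def position_def of_bool_def if_distrib[of "\<lambda>c. c * _"] cong: if_cong)
  finally show ?thesis .
qed

lemma block_J_square: "block_J *v (block_J *v x) = - x"
  by (simp add: vec_eq_iff block_J_mult position_def)
    (simp add: J_def forall_2 matrix_vector_mult_def sum_2)

lemma map_matrix_of_real_block_matrix_mult:
  "map_matrix f (block_matrix A B C D) *v v = (\<chi> s. case s of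
      Inl p \<Rightarrow> (map_matrix f A *v (\<chi> r. v $ Inl r) + map_matrix f B *v (\<chi> r. v $ Inr r)) $ p
    | Inr p \<Rightarrow> (map_matrix f C *v (\<chi> r. v $ Inl r) + map_matrix f D *v (\<chi> r. v $ Inr r)) $ p)"
  by (simp add: vec_eq_iff matrix_vector_mult_def block_matrix_def map_matrix_def
      sum.Plus split: sum.split flip: UNIV_Plus_UNIV)

text \<open>
  The vector \<open>x - \<i> \<^bold>J x\<close> is an eigenvector of \<open>\<^bold>J\<close> with eigenvalue \<open>\<i>\<close> and of the Hessian, so the
  eigenvalue condition becomes \<open>c\<^sup>2 = 2 \<omega> \<i> c + \<omega>\<^sup>2 + \<kappa>\<close>, that is \<open>(c - \<i> \<omega>)\<^sup>2 = \<kappa>\<close>.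
\<close>

lemma linearly_unstable_if_hessian_eigenplane:
  assumes "x \<noteq> 0" "\<kappa> > 0"
    and "hessian U z *v x = \<kappa> *\<^sub>R x"
    and "hessian U z *v (block_J *v x) = \<kappa> *\<^sub>R (block_J *v x)"
  shows "linearly_unstable U \<omega> z"
proof -
  define y where "y = - (block_J *v x)"
  \<comment> \<open>The root of (c - i \<omega>)^2 = \<kappa> with positive real part.\<close>
  define c where "c = Complex (sqrt \<kappa>) \<omega>"
  define e where "e = (\<chi> p. Complex (x $ p) (y $ p))"
  \<comment> \<open>In the first-order system the second block is the velocity, hence
    \<open>c\<close> times the first.\<close>
  define v where "v = (\<chi> s. case s of Inl p \<Rightarrow> e $ p | Inr p \<Rightarrow> c * e $ p)"
  \<comment> \<open>The last two equations say that \<open>block_J\<close> maps x + i y to -y + i x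
    = i (x + i y).\<close>
  have y: "hessian U z *v y = \<kappa> *\<^sub>R y" "block_J *v x = - y" "block_J *v y = x"
    using assms by (simp_all add: y_def block_J_square linear_neg[OF matrix_vector_mul_linear])
  let ?f = "map_matrix complex_of_real"
  \<comment> \<open>A real matrix acts separately on the real part \<open>x\<close> and the
    imaginary part \<open>y\<close> of \<open>e\<close>, so the real identities suffice here and for
    \<open>block_J\<close>.\<close>
  have 1: "?f (\<omega>\<^sup>2 *\<^sub>R mat 1 + hessian U z) *v e = (\<omega>\<^sup>2 + \<kappa>) *s e"
    unfolding e_def map_matrix_of_real_mult_Complex
    by (simp add: y assms matrix_vector_mult_add_rdistrib scaleR_matrix_vector_assoc[symmetric] vec_eq_iff complex_eq_iff algebra_simps)
  have 2: "?f ((2 * \<omega>) *\<^sub>R block_J) *v e = (2 * \<omega> * \<i>) *s e"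
    unfolding e_def map_matrix_of_real_mult_Complex
    by (simp add: y scaleR_matrix_vector_assoc[symmetric] vec_eq_iff complex_eq_iff)
  have 0: "?f 0 = 0" "?f (mat 1) = mat 1"
    by (simp_all add: vec_eq_iff mat_def)
  have "c\<^sup>2 = 2 * \<omega> * \<i> * c + \<omega>\<^sup>2 + \<kappa>"
    using \<open>\<kappa> > 0\<close> by (simp add: c_def complex_eq_iff power2_eq_square)
  then have "c * (c * a) = of_real (\<omega>\<^sup>2 + \<kappa>) * a + c * (of_real (2 * \<omega>) * \<i> * a)" for a
    unfolding mult.assoc[symmetric] power2_eq_square[symmetric]
    by (simp only:) (simp add: algebra_simps)
  then have 3: "(\<omega>\<^sup>2 + \<kappa>) *s e + c *s ((2 * \<omega> * \<i>) *s e) = c *s (c *s e)"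
    by (simp only: vec_eq_iff vector_add_component vector_smult_component) simp
  have v_parts: "(\<chi> r. v $ Inl r) = e" "(\<chi> r. v $ Inr r) = c *s e"
    by (simp_all add: v_def vec_eq_iff)
  have "?f (linearization U \<omega> z) *v v =
      (\<chi> s. case s of Inl p \<Rightarrow> (c *s e) $ p | Inr p \<Rightarrow> (c *s (c *s e)) $ p)"
    unfolding linearization_def map_matrix_of_real_block_matrix_mult v_parts
    by (simp only: 0 1 2 3 vector_scalar_commute matrix_vector_mult_0 matrix_vector_mul_lid add_0_left)
  also have "\<dots> = c *s v"
    by (simp add: v_def vec_eq_iff split: sum.split)
  finally have "?f (linearization U \<omega> z) *v v = c *s v" .
  moreover have "v \<noteq> 0"
  proof -
    obtain p where "x $ p \<noteq> 0"
      using \<open>x \<noteq> 0\<close> by (auto simp: vec_eq_iff)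
    then have "v $ Inl p \<noteq> 0"
      by (simp add: v_def e_def complex_eq_iff)
    then show ?thesis
      by auto
  qed
  moreover have "Re c > 0"
    using \<open>\<kappa> > 0\<close> by (simp add: c_def)
  ultimately show ?thesis
    unfolding linearly_unstable_def is_eigenvalue_def by blast
qed

section \<open>The Hessian at the equilateral triangle\<close>

lemma manev_stiffness_sqrt_3:
  assumes "norm d = sqrt 3"
  shows "manev_stiffness d h = ((1 / (3 * sqrt 3) + 8 / 27) * (d \<bullet> h)) *\<^sub>R d - (1 / (3 * sqrt 3) + 2 / 9) *\<^sub>R h"
  unfolding manev_stiffness_def assms
  by (simp add: sqrt_3_powers)

lemma manev_hessian_equilateral_triangle_nth:
  fixes h :: "real ^ (3 \<times> 2)"
  defines "t \<equiv> equilateral_triangle"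
  shows "manev_hessian t h $ (i, k) = (\<Sum>j\<in>UNIV.
    (1 / (3 * sqrt 3) + 8 / 27) * (\<Sum>l\<in>UNIV. (t $ (i, l) - t $ (j, l)) * (h $ (i, l) - h $ (j, l))) *
      (t $ (i, k) - t $ (j, k))
    - (1 / (3 * sqrt 3) + 2 / 9) * (h $ (i, k) - h $ (j, k)))"
proof -
  have "manev_stiffness (position t i - position t j) (position h i - position h j) =
    ((1 / (3 * sqrt 3) + 8 / 27) * ((position t i - position t j) \<bullet> (position h i - position h j))) *\<^sub>R
      (position t i - position t j) - (1 / (3 * sqrt 3) + 2 / 9) *\<^sub>R (position h i - position h j)" for j
  \<comment> \<open>For \<open>i = j\<close> the distance is not sqrt 3, but both difference vectors
    are zero and so are both sides.\<close>
  proof (cases "i = j")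
    case True
    then show ?thesis
      by (simp add: manev_stiffness_def)
  next
    case False
    then show ?thesis
      unfolding t_def by (rule manev_stiffness_sqrt_3[OF norm_equilateral_triangle])
  qed
  then show ?thesis
    by (simp add: manev_hessian_nth inner_vec_def position_def)
qed

text \<open>Reflecting the triangle in the first axis is complex conjugation of its vertices, so
  \<open>x\<close> is the mode with u = 1. As \<open>J\<close> is multiplication by -i,
  \<open>block_J *v x\<close> is the mode with u = -i.\<close>

lemma manev_hessian_equilateral_triangle:
  defines "x \<equiv> \<chi> p. (if snd p = 1 then 1 else -1) * equilateral_triangle $ p"
    and "\<kappa> \<equiv> 2 / 3 + 1 / (2 * sqrt 3)"
  shows "manev_hessian equilateral_triangle x = \<kappa> *\<^sub>R x"
    and "manev_hessian equilateral_triangle (block_J *v x) = \<kappa> *\<^sub>R (block_J *v x)"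
proof -
  define \<alpha> \<beta> :: real where "\<alpha> = 1 / (3 * sqrt 3) + 8 / 27" and "\<beta> = 1 / (3 * sqrt 3) + 2 / 9"
  \<comment> \<open>For h = u conj(d) and |d|^2 = 3, (d . h) d = (3 h + conj(u) d^3) / 2. Summed
    over the other vertices, the cubes cancel and the h add up to three times the mode, which
    explains 9/2 and 3. With \<alpha> and \<beta> kept opaque, the entrywise check involves no root
    but that in the coordinates.\<close>
  have \<kappa>: "\<kappa> = 9 / 2 * \<alpha> - 3 * \<beta>"
    by (simp add: \<kappa>_def \<alpha>_def \<beta>_def field_simps)
  have s: "sqrt 3 * (sqrt 3 * y) = 3 * y" "sqrt 3 * (y * sqrt 3) = 3 * y" for y :: real
    by (simp_all add: mult.left_commute flip: mult.assoc)
  have x: "x $ (1, 1) = 1" "x $ (1, 2) = 0" "x $ (2, 1) = - 1 / 2" "x $ (2, 2) = - sqrt 3 / 2"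
      "x $ (3, 1) = - 1 / 2" "x $ (3, 2) = sqrt 3 / 2"
    and t: "equilateral_triangle $ (1, 1) = 1" "equilateral_triangle $ (1, 2) = 0"
      "equilateral_triangle $ (2, 1) = - 1 / 2" "equilateral_triangle $ (2, 2) = sqrt 3 / 2"
      "equilateral_triangle $ (3, 1) = - 1 / 2" "equilateral_triangle $ (3, 2) = - sqrt 3 / 2"
    by (simp_all add: x_def equilateral_triangle_def)
  have y: "(block_J *v x) $ (i, 1) = x $ (i, 2)" "(block_J *v x) $ (i, 2) = - x $ (i, 1)" for i
    by (simp_all add: block_J_mult) (simp_all add: J_def matrix_vector_mult_def sum_2 position_def)
  note hessian_nth = manev_hessian_equilateral_triangle_nth[folded \<alpha>_def \<beta>_def]
  show "manev_hessian equilateral_triangle x = \<kappa> *\<^sub>R x"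
    by (simp add: vec_eq_iff split_paired_All forall_3 forall_2 hessian_nth sum_3 sum_2 x t \<kappa>)
      (simp add: field_simps s)
  show "manev_hessian equilateral_triangle (block_J *v x) = \<kappa> *\<^sub>R (block_J *v x)"
    by (simp add: vec_eq_iff split_paired_All forall_3 forall_2 hessian_nth sum_3 sum_2 y x t \<kappa>)
      (simp add: field_simps s)
qed

theorem mainTheorem3:
  fixes \<omega> :: real
  assumes "\<omega> > 0"
  shows "(relative_equilibrium manev \<omega> equilateral_triangle \<longleftrightarrow> \<omega>\<^sup>2 = 2 / 3 + 1 / sqrt 3) \<and>
         (relative_equilibrium manev \<omega> equilateral_triangle \<longrightarrow> linearly_unstable manev \<omega> equilateral_triangle)"
proof -
  have inj: "inj (position equilateral_triangle)"
    using inj_position_if_equidistant[OF norm_equilateral_triangle] by simp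
  have nz: "(\<chi> p. (if snd p = 1 then 1 else -1) * equilateral_triangle $ p) \<noteq> 0"
    "equilateral_triangle \<noteq> 0"
    by (auto simp: vec_eq_iff equilateral_triangle_def intro!: exI[of _ 1])
  have "linearly_unstable manev \<omega> equilateral_triangle"
    by (rule linearly_unstable_if_hessian_eigenplane[OF nz(1), where \<kappa> = "2 / 3 + 1 / (2 * sqrt 3)"])
      (simp_all add: hessian_manev[OF inj] manev_hessian_equilateral_triangle add_pos_pos)
  then show ?thesis
    using relative_equilibrium_iff_central[OF assms nz(2) GDERIV_manev_equilateral_triangle] by blast
qed

end
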